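(* Let $\Omega=\{(p,q)\in\mathbb{R}^2: p\ge0\text{ or }3q\le p\le0\}$, and let $q,p_1,p_2\in\mathbb{R}$ with $(p_1,q),(p_2,q)\in\Omega$. Consider the double inequality $$\left(\left(1-\tfrac{p_1}{3q}\right)a^q+\tfrac{p_1}{3q}b^q\right)^{1/p_1}a^{1-q/p_1}<SB(b,a)<\left(\left(1-\tfrac{p_2}{3q}\right)a^q+\tfrac{p_2}{3q}b^q\right)^{1/p_2}a^{1-q/p_2}\qquad(\ast)$$ for all $b>a>0$. (i) When $q\in[34/35,\infty)$, $(\ast)$ holds for all $b>a>0$ if and only if $p_1\ge3q-8/5$ and $p_2\le q$. (ii) When $q\in[4/5,34/35)$, the left-hand inequality in $(\ast)$ holds for all $b>a>0$ whenever $p_1\ge 23q/17$, and the right-hand inequality holds for all $b>a>0$ if and only if $p_2\le q$. (iii) When $q\in(0,4/5)$, the left-hand inequality in $(\ast)$ holds for all $b>a>0$ whenever $p_1\ge23q/17$, and the right-hand inequality holds for all $b>a>0$ if and only if $p_2\le 3q-8/5$. (iv) When $q\in(-\infty,0]$, $(\ast)$ holds for all $b>a>0$ if and only if $p_1\ge q$ and $p_2\le3q-8/5$.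
   Context: For $b>a>0$, $SB(b,a)=\dfrac{\sqrt{b^2-a^2}}{\operatorname{arccosh}(b/a)}$ is the Schwab–Borchardt mean. Convention: for zero parameters, the expression $\left(\left(1-\frac{p}{3q}\right)a^q+\frac{p}{3q}b^q\right)^{1/p}a^{1-q/p}$ is understood as the corresponding limit: with $t=b/a$ it means $a\exp\frac{t^q-1}{3q}$ if $p=0$, $q\ne0$; $a\left(\frac p3\ln t+1\right)^{1/p}$ if $p>0$, $q=0$; and $a\,t^{1/3}$ if $p=q=0$. *)

theory Defs
  imports Complex_Main
begin

definition SB :: "real \<Rightarrow> real \<Rightarrow> real" where
  "SB b a = sqrt (b\<^sup>2 - a\<^sup>2) / arcosh (b / a)"

definition Omega :: "(real \<times> real) set" where
  "Omega = {(p, q). p \<ge> 0 \<or> (3 * q \<le> p \<and> p \<le> 0)}"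

(* The expression ((1 - p/(3q)) a^q + p/(3q) b^q)^(1/p) a^(1 - q/p), with its limits at zero
   parameters. For (p, q) in Omega and b > a > 0 every base of powr below is positive, and so
   is the argument of ln, so that powr is the ordinary real power. On Omega, q = 0 forces
   p >= 0, so the third branch is used only with p > 0. *)
definition M :: "real \<Rightarrow> real \<Rightarrow> real \<Rightarrow> real \<Rightarrow> real" where
  "M p q b a =
    (if p = 0 \<and> q = 0 then a * (b / a) powr (1 / 3)
     else if p = 0 then a * exp (((b / a) powr q - 1) / (3 * q))
     else if q = 0 then a * (p / 3 * ln (b / a) + 1) powr (1 / p)
     else ((1 - p / (3 * q)) * a powr q + p / (3 * q) * b powr q) powr (1 / p)
            * a powr (1 - q / p))"

end

theory Submission
  imports Defs "HOL-Real_Asymp.Real_Asymp"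
begin

text \<open>
  By homogeneity take \<open>a = 1\<close> and substitute \<open>b = cosh x\<close>, so that the Schwab--Borchardt mean is
  \<open>sinh x / x\<close>. With the Box--Cox transform \<open>U\<^sub>p(s) = (s\<^sup>p - 1) / p\<close>, \<open>U\<^sub>0 = ln\<close>, comparing the
  means amounts to the sign of \<open>f(x) = 3 U\<^sub>p(sinh x / x) - U\<^sub>q(cosh x)\<close>. The sign of \<open>f'\<close> is that
  of a function \<open>h\<close> with \<open>h(0) = 0\<close> and \<open>h' = \<alpha> + p \<beta> - q tanh\<close>, where \<open>\<alpha>\<close> and \<open>\<beta>\<close> do not depend
  on \<open>p, q\<close>. All sufficient conditions follow from \<open>\<alpha> > 0\<close>, \<open>5 \<alpha> < 4 (tanh - \<beta>)\<close> and
  \<open>34 tanh - 46 \<beta> < 35 \<alpha>\<close>; cleared of denominators, these compare power series in \<open>x\<^sup>2\<close>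
  coefficient by coefficient. The necessary conditions come from the limit \<open>8/15 + p/3 - q\<close> of
  \<open>h'(x) / x\<close> at \<open>0\<close> and from the growth of \<open>f\<close> at infinity.
\<close>

section \<open>Power series of hyperbolic terms over a common basis\<close>

lemma sums_cosh: "(\<lambda>n. k ^ (2 * n) * (x ^ (2 * n) / fact (2 * n))) sums cosh (k * x)"
  for k x :: real
proof -
  have "(\<lambda>n. if even n then (k * x) ^ n /\<^sub>R fact n else 0) sums cosh (k * x)"
    by (rule cosh_converges)
  then have "(\<lambda>n. (k * x) ^ (2 * n) /\<^sub>R fact (2 * n)) sums cosh (k * x)"
    by (subst (asm) sums_mono_reindex[of "\<lambda>n. 2 * n", symmetric])
       (auto simp: strict_mono_def elim!: evenE)
  then show ?thesis
    by (simp add: power_mult_distrib field_simps)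
qed

text \<open>The factor \<open>x\<close> turns the odd powers of \<open>sinh\<close> into even ones,
  so this series shares the basis \<open>x ^ (2 * n) / fact (2 * n)\<close> with \<open>cosh\<close>
  and both can be combined termwise. Dividing by \<open>k\<close> replaces an exponent
  \<open>2 * n - 1\<close>.\<close>

lemma sums_times_sinh:
  fixes k x :: real
  assumes "k \<noteq> 0"
  shows "(\<lambda>n. 2 * real n * k ^ (2 * n) / k * (x ^ (2 * n) / fact (2 * n))) sums (x * sinh (k * x))"
proof -
  have "(\<lambda>n. if even n then 0 else (k * x) ^ n /\<^sub>R fact n) sums sinh (k * x)"
    by (rule sinh_converges)
  then have "(\<lambda>n. (k * x) ^ (2 * n + 1) /\<^sub>R fact (2 * n + 1)) sums sinh (k * x)"
    by (subst (asm) sums_mono_reindex[of "\<lambda>n. 2 * n + 1", symmetric])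
       (auto simp: strict_mono_def elim!: oddE)
  then have "(\<lambda>n. x * ((k * x) ^ (2 * n + 1) /\<^sub>R fact (2 * n + 1))) sums (x * sinh (k * x))"
    by (rule sums_mult)
  also have "(\<lambda>n. x * ((k * x) ^ (2 * n + 1) /\<^sub>R fact (2 * n + 1))) =
      (\<lambda>n. 2 * real (Suc n) * k ^ (2 * Suc n) / k * (x ^ (2 * Suc n) / fact (2 * Suc n)))"
    using assms by (simp add: fun_eq_iff power_mult_distrib divide_simps del: of_nat_Suc)
       (simp add: algebra_simps)
  \<comment> \<open>Undoing the index shift adds the term at 0, which vanishes because of the factor
    \<open>n\<close>.\<close>
  finally show ?thesis
    by (subst (asm) sums_Suc_iff) simp
qed

lemma sums_square_times_cosh:
  fixes k x :: real
  assumes "k \<noteq> 0"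
  shows "(\<lambda>n. 2 * real n * (2 * real n - 1) * k ^ (2 * n) / k\<^sup>2 * (x ^ (2 * n) / fact (2 * n))) sums
           (x\<^sup>2 * cosh (k * x))"
proof -
  have "(\<lambda>n. x\<^sup>2 * (k ^ (2 * n) * (x ^ (2 * n) / fact (2 * n)))) sums (x\<^sup>2 * cosh (k * x))"
    by (intro sums_mult sums_cosh)
  also have "(\<lambda>n. x\<^sup>2 * (k ^ (2 * n) * (x ^ (2 * n) / fact (2 * n)))) =
      (\<lambda>n. 2 * real (Suc n) * (2 * real (Suc n) - 1) * k ^ (2 * Suc n) / k\<^sup>2
             * (x ^ (2 * Suc n) / fact (2 * Suc n)))"
    using assms by (simp add: fun_eq_iff power2_eq_square divide_simps)
  finally show ?thesis
    by (subst (asm) sums_Suc_iff) simp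
qed

lemma even_power_series_pos:
  fixes a :: "nat \<Rightarrow> real"
  assumes "(\<lambda>n. a n * (x ^ (2 * n) / fact (2 * n))) sums s" "x > 0"
    and "\<And>n. a n \<ge> 0" "a m > 0"
  shows "s > 0"
  using suminf_pos2[OF sums_summable[OF assms(1)], of m] assms sums_unique[OF assms(1)]
  by simp

section \<open>Three hyperbolic inequalities by comparison of coefficients\<close>

lemma cosh_triple: "cosh (3 * x) = 4 * cosh x ^ 3 - 3 * cosh x" for x :: real
proof -
  have "cosh (2 * x + x) = (2 * (cosh x)\<^sup>2 - 1) * cosh x + 2 * ((cosh x)\<^sup>2 - 1) * cosh x"
    unfolding cosh_add sinh_double cosh_double_cosh sinh_square_eq[symmetric]
    by (simp add: power2_eq_square)
  then show ?thesis
    by (simp add: algebra_simps power2_eq_square power3_eq_cube)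
qed

lemma sinh_triple: "sinh (3 * x) = 4 * sinh x * (cosh x)\<^sup>2 - sinh x" for x :: real
proof -
  have "sinh (2 * x + x) = 4 * sinh x * (cosh x)\<^sup>2 - sinh x"
    unfolding sinh_add sinh_double cosh_double_cosh by (simp add: power2_eq_square algebra_simps)
  then show ?thesis by simp
qed

text \<open>Linearization to the arguments \<open>x\<close> and \<open>3 * x\<close> makes the
  series above applicable to products.\<close>

lemma cosh_times_sinh_square: "cosh x * (sinh x)\<^sup>2 = (cosh (3 * x) - cosh x) / 4" for x :: real
  unfolding cosh_triple sinh_square_eq
  by (simp add: algebra_simps power2_eq_square power3_eq_cube)

text \<open>Divided by \<open>x\<^sup>2 * cosh x\<close> this is the Wilker type inequality
  \<open>2 < (sinh x / x)\<^sup>2 + tanh x / x\<close>; it will make \<open>alpha\<close> positive.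
  The coefficients vanish for \<open>n < 3\<close>, and from there \<open>9 ^ n\<close> outgrows the
  quadratic terms.\<close>

lemma wilker_hyperbolic:
  fixes x :: real
  assumes "x > 0"
  shows "2 * x\<^sup>2 * cosh x < cosh x * (sinh x)\<^sup>2 + x * sinh x"
proof -
  define a :: "nat \<Rightarrow> real" where "a n = (9 ^ n - 1) / 4 + 2 * real n - 4 * real n * (2 * real n - 1)" for n
  have "(\<lambda>n. 1 / 4 * (3 ^ (2 * n) * (x ^ (2 * n) / fact (2 * n)))
       - 1 / 4 * (1 ^ (2 * n) * (x ^ (2 * n) / fact (2 * n)))
       + 2 * real n * 1 ^ (2 * n) / 1 * (x ^ (2 * n) / fact (2 * n))
       - 2 * (2 * real n * (2 * real n - 1) * 1 ^ (2 * n) / 1\<^sup>2 * (x ^ (2 * n) / fact (2 * n))))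
     sums (1 / 4 * cosh (3 * x) - 1 / 4 * cosh (1 * x) + x * sinh (1 * x)
             - 2 * (x\<^sup>2 * cosh (1 * x)))" (is "?t sums ?s")
    by (intro sums_add sums_diff sums_mult sums_cosh sums_times_sinh sums_square_times_cosh) auto
  also have "?t = (\<lambda>n. a n * (x ^ (2 * n) / fact (2 * n)))"
    by (simp add: a_def fun_eq_iff power_mult divide_simps) (simp add: algebra_simps power2_eq_square)
  also have "?s =
     cosh x * (sinh x)\<^sup>2 + x * sinh x - 2 * x\<^sup>2 * cosh x"
    unfolding cosh_times_sinh_square
    unfolding cosh_triple sinh_triple
    by (simp add: field_simps)
  finally have "(\<lambda>n. a n * (x ^ (2 * n) / fact (2 * n))) sums \<dots>" .
  moreover have "a n \<ge> 0" for n
  proof (cases "n \<ge> 3")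
    case True
    have "(9::real) ^ n \<ge> 32 * (real n)\<^sup>2 - 24 * n + 1"
      using True
    proof (induction n rule: nat_induct_at_least)
      case (Suc n)
      then have "3 * real n \<le> real n * real n"
        by (intro mult_right_mono) auto
      then have "32 * (real (Suc n))\<^sup>2 - 24 * Suc n + 1 \<le> 9 * (32 * (real n)\<^sup>2 - 24 * n + 1)"
        by (simp add: power2_eq_square algebra_simps)
      with Suc show ?case by simp
    qed simp
    then show ?thesis by (simp add: a_def power2_eq_square field_simps)
  next
    case False
    then have "n = 0 \<or> n = 1 \<or> n = 2" by auto
    then show ?thesis by (auto simp: a_def)
  qed
  moreover have "a 3 > 0" by (simp add: a_def)
  ultimately show ?thesis
    using even_power_series_pos assms by fastforce
qed

text \<open>The difference of the sides is the numerator of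
  \<open>4 * (tanh x - beta x) - 5 * alpha x\<close>. Its coefficients vanish for
  \<open>n < 4\<close>; afterwards \<open>2 * n / 3\<close> exceeds \<open>9 / 4\<close>, so the
  \<open>x * sinh (3 * x)\<close> part dominates.\<close>

lemma right_bound_hyperbolic:
  fixes x :: real
  assumes "x > 0"
  shows "9 * (cosh x * (sinh x)\<^sup>2) < 6 * x\<^sup>2 * cosh x + x * sinh x * (4 * (cosh x)\<^sup>2 - 1)"
proof -
  define a :: "nat \<Rightarrow> real"
    where "a n = 12 * real n * (2 * real n - 1) + 2 * real n / 3 * 9 ^ n - 9 / 4 * (9 ^ n - 1)" for n
  have "(\<lambda>n. 6 * (2 * real n * (2 * real n - 1) * 1 ^ (2 * n) / 1\<^sup>2 * (x ^ (2 * n) / fact (2 * n)))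
       + 2 * real n * 3 ^ (2 * n) / 3 * (x ^ (2 * n) / fact (2 * n))
       - 9 / 4 * (3 ^ (2 * n) * (x ^ (2 * n) / fact (2 * n))
                    - 1 ^ (2 * n) * (x ^ (2 * n) / fact (2 * n))))
     sums (6 * (x\<^sup>2 * cosh (1 * x)) + x * sinh (3 * x) - 9 / 4 * (cosh (3 * x) - cosh (1 * x)))" (is "?t sums ?s")
    by (intro sums_add sums_diff sums_mult sums_cosh sums_times_sinh sums_square_times_cosh) auto
  also have "?t = (\<lambda>n. a n * (x ^ (2 * n) / fact (2 * n)))"
    by (simp add: a_def fun_eq_iff power_mult divide_simps) (simp add: algebra_simps power2_eq_square)
  also have "?s =
     6 * x\<^sup>2 * cosh x + x * sinh x * (4 * (cosh x)\<^sup>2 - 1) - 9 * (cosh x * (sinh x)\<^sup>2)"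
    unfolding cosh_times_sinh_square
    unfolding cosh_triple sinh_triple
    by (simp add: field_simps)
  finally have "(\<lambda>n. a n * (x ^ (2 * n) / fact (2 * n))) sums \<dots>" .
  moreover have "a n \<ge> 0" for n
  proof (cases "n \<ge> 4")
    case True
    then have "2 * real n / 3 * 9 ^ n \<ge> 9 / 4 * (9 ^ n :: real)"
      by (intro mult_right_mono) auto
    moreover have "12 * real n * (2 * real n - 1) \<ge> (0 :: real)"
      using True by simp
    ultimately show ?thesis unfolding a_def right_diff_distrib[of "9 / 4"] by linarith
  next
    case False
    then have "n = 0 \<or> n = 1 \<or> n = 2 \<or> n = 3" by auto
    then show ?thesis by (auto simp: a_def)
  qed
  moreover have "a 4 > 0" by (simp add: a_def)
  ultimately show ?thesis
    using even_power_series_pos assms by fastforce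
qed

text \<open>The difference of the sides is the numerator of
  \<open>35 * alpha x + 46 * beta x - 34 * tanh x\<close>. Its coefficients vanish for
  \<open>n < 5\<close>: these constants cancel the terms of orders 1 and 3 of that combination at
  0.\<close>

lemma left_bound_hyperbolic:
  fixes x :: real
  assumes "x > 0"
  shows "36 * x\<^sup>2 * cosh x + 58 * x * sinh x * (cosh x)\<^sup>2 <
           12 * x\<^sup>2 * cosh x ^ 3 + x * sinh x + 81 * (cosh x * (sinh x)\<^sup>2)"
proof -
  define a :: "nat \<Rightarrow> real"
    where "a n = 9 ^ n * ((4 * n\<^sup>2 - 31 * n) / 3 + 81 / 4) - 108 * n\<^sup>2 + 27 * n - 81 / 4" for n
  have "(\<lambda>n. 3 * (2 * real n * (2 * real n - 1) * 3 ^ (2 * n) / 3\<^sup>2 * (x ^ (2 * n) / fact (2 * n)))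
       - 27 * (2 * real n * (2 * real n - 1) * 1 ^ (2 * n) / 1\<^sup>2 * (x ^ (2 * n) / fact (2 * n)))
       - 29 / 2 * (2 * real n * 3 ^ (2 * n) / 3 * (x ^ (2 * n) / fact (2 * n)))
       - 27 / 2 * (2 * real n * 1 ^ (2 * n) / 1 * (x ^ (2 * n) / fact (2 * n)))
       + 81 / 4 * (3 ^ (2 * n) * (x ^ (2 * n) / fact (2 * n))
                    - 1 ^ (2 * n) * (x ^ (2 * n) / fact (2 * n))))
     sums (3 * (x\<^sup>2 * cosh (3 * x)) - 27 * (x\<^sup>2 * cosh (1 * x)) - 29 / 2 * (x * sinh (3 * x))
             - 27 / 2 * (x * sinh (1 * x)) + 81 / 4 * (cosh (3 * x) - cosh (1 * x)))" (is "?t sums ?s")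
    by (intro sums_add sums_diff sums_mult sums_cosh sums_times_sinh sums_square_times_cosh) auto
  also have "?t = (\<lambda>n. a n * (x ^ (2 * n) / fact (2 * n)))"
    by (simp add: a_def fun_eq_iff power_mult divide_simps) (simp add: algebra_simps power2_eq_square)
  also have "?s =
     12 * x\<^sup>2 * cosh x ^ 3 + x * sinh x + 81 * (cosh x * (sinh x)\<^sup>2)
       - (36 * x\<^sup>2 * cosh x + 58 * x * sinh x * (cosh x)\<^sup>2)"
    unfolding cosh_times_sinh_square
    unfolding cosh_triple sinh_triple
    by (simp add: field_simps)
  finally have "(\<lambda>n. a n * (x ^ (2 * n) / fact (2 * n))) sums \<dots>" .
  moreover have "a n \<ge> 0" for n
  proof (cases "n \<ge> 5")
    case True
    \<comment> \<open>Once the factor of \<open>9 ^ n\<close> in \<open>a n\<close> is bounded below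
      by \<open>1 / 4\<close>, this is what \<open>a n \<ge> 0\<close> requires.\<close>
    have "(9::real) ^ n \<ge> 432 * (real n)\<^sup>2 - 108 * n + 81"
      using True
    proof (induction n rule: nat_induct_at_least)
      case (Suc n)
      then have "5 * real n \<le> real n * real n"
        by (intro mult_right_mono) auto
      then have "432 * (real (Suc n))\<^sup>2 - 108 * Suc n + 81 \<le> 9 * (432 * (real n)\<^sup>2 - 108 * n + 81)"
        by (simp add: power2_eq_square algebra_simps)
      with Suc show ?case by simp
    qed simp
    moreover have "9 ^ n * (1 / 4) \<le> 9 ^ n * ((4 * (real n)\<^sup>2 - 31 * real n) / 3 + 81 / 4)"
    proof -
      \<comment> \<open>The factor of \<open>9 ^ n\<close> exceeds \<open>1 / 4\<close> by
        \<open>4 / 3\<close> times this product.\<close>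
      have "0 \<le> (real n - 15 / 4) * (real n - 4)"
        using True by simp
      then show ?thesis
        by (intro mult_left_mono) (auto simp: power2_eq_square field_simps)
    qed
    ultimately show ?thesis unfolding a_def by linarith
  next
    case False
    then have "n = 0 \<or> n = 1 \<or> n = 2 \<or> n = 3 \<or> n = 4" by auto
    then show ?thesis by (auto simp: a_def)
  qed
  moreover have "a 5 > 0" by (simp add: a_def)
  ultimately show ?thesis
    using even_power_series_pos assms by fastforce
qed


section \<open>Bounds for \<open>alpha\<close> and the sign of \<open>slope\<close>\<close>

lemma sinh_less_times_cosh:
  fixes x :: real
  assumes "x > 0"
  shows "sinh x < x * cosh x"
proof -
  have "0 * cosh 0 - sinh 0 < x * cosh x - sinh x"
  proof (rule DERIV_pos_imp_increasing_open[OF assms])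
    fix y :: real
    assume "0 < y"
    then have "((\<lambda>y. y * cosh y - sinh y) has_real_derivative y * sinh y) (at y)" "y * sinh y > 0"
      by (auto intro!: derivative_eq_intros)
    then show "\<exists>d. ((\<lambda>y. y * cosh y - sinh y) has_real_derivative d) (at y) \<and> 0 < d"
      by blast
  qed (auto intro!: continuous_intros)
  then show ?thesis by simp
qed

text \<open>The derivative of \<open>ln (3 * (x * cosh x - sinh x) / (x\<^sup>2 * sinh x)) - ln
  (sinh x / x) + ln (cosh x)\<close>.\<close>

definition alpha :: "real \<Rightarrow> real" where
  "alpha x = x * sinh x / (x * cosh x - sinh x) - 1 / x - 2 * cosh x / sinh x + tanh x"

text \<open>The Langevin function, which is the derivative of
  \<open>ln (sinh x / x)\<close>.\<close>

definition beta :: "real \<Rightarrow> real" where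
  "beta x = cosh x / sinh x - 1 / x"

definition slope :: "real \<Rightarrow> real \<Rightarrow> real \<Rightarrow> real" where
  "slope p q x = alpha x + p * beta x - q * tanh x"

context
  fixes x :: real
  assumes x: "x > 0"
begin

lemma common_denominator_pos: "x * sinh x * cosh x * (x * cosh x - sinh x) > 0"
  using x sinh_less_times_cosh[OF x] by simp

lemma alpha_over_common_denominator:
  "alpha x = (cosh x * (sinh x)\<^sup>2 + x * sinh x - 2 * x\<^sup>2 * cosh x) /
     (x * sinh x * cosh x * (x * cosh x - sinh x))"
proof -
  define c s where "c = cosh x" and "s = sinh x"
  have "c\<^sup>2 = s\<^sup>2 + 1"
    by (simp add: c_def s_def cosh_square_eq)
  moreover have "c \<noteq> 0" "s \<noteq> 0" "x * c - s \<noteq> 0"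
    using x sinh_less_times_cosh[OF x] by (auto simp: c_def s_def)
  moreover have "x * s * (x * s * c) - s * c * (x * c - s) - 2 * c * (x * c * (x * c - s))
      + s * (x * s * (x * c - s)) = c * s\<^sup>2 + x * s - 2 * x\<^sup>2 * c"
    using \<open>c\<^sup>2 = s\<^sup>2 + 1\<close> by algebra
  ultimately show ?thesis
    using x unfolding alpha_def tanh_def c_def[symmetric] s_def[symmetric]
    by (simp add: field_simps)
qed

lemma beta_over_common_denominator:
  "beta x = cosh x * (x * cosh x - sinh x)\<^sup>2 / (x * sinh x * cosh x * (x * cosh x - sinh x))"
  using x sinh_less_times_cosh[OF x] by (simp add: beta_def field_simps power2_eq_square)

lemma tanh_over_common_denominator:
  "tanh x = x * (sinh x)\<^sup>2 * (x * cosh x - sinh x) / (x * sinh x * cosh x * (x * cosh x - sinh x))"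
  using x sinh_less_times_cosh[OF x] by (simp add: tanh_def field_simps power2_eq_square)

lemma alpha_pos: "alpha x > 0"
  using common_denominator_pos wilker_hyperbolic[OF x] by (simp add: alpha_over_common_denominator)

lemma beta_pos: "beta x > 0"
  using x sinh_less_times_cosh[OF x] by (simp add: beta_def field_simps)

text \<open>Over the common denominator this is \<open>right_bound_hyperbolic\<close>. Both sides
  behave like \<open>8 / 3 * x\<close> at 0.\<close>

lemma alpha_upper_bound: "5 * alpha x < 4 * (tanh x - beta x)"
proof -
  define c s where "c = cosh x" and "s = sinh x"
  have "c\<^sup>2 = s\<^sup>2 + 1"
    by (simp add: c_def s_def cosh_square_eq)
  then have "4 * (x * s\<^sup>2 * (x * c - s) - c * (x * c - s)\<^sup>2) - 5 * (c * s\<^sup>2 + x * s - 2 * x\<^sup>2 * c) =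
      6 * x\<^sup>2 * c + x * s * (4 * c\<^sup>2 - 1) - 9 * (c * s\<^sup>2)"
    by algebra
  also have "\<dots> > 0"
    using right_bound_hyperbolic[OF x] by (simp add: c_def s_def)
  finally show ?thesis
    using common_denominator_pos
    unfolding alpha_over_common_denominator beta_over_common_denominator tanh_over_common_denominator
    unfolding times_divide_eq_right diff_divide_distrib[symmetric]
    by (intro divide_strict_right_mono) (simp_all add: c_def s_def)
qed

lemma alpha_lower_bound: "34 * tanh x - 46 * beta x < 35 * alpha x"
proof -
  define c s where "c = cosh x" and "s = sinh x"
  have "c\<^sup>2 = s\<^sup>2 + 1"
    by (simp add: c_def s_def cosh_square_eq)
  then have "35 * (c * s\<^sup>2 + x * s - 2 * x\<^sup>2 * c) -
        (34 * (x * s\<^sup>2 * (x * c - s)) - 46 * (c * (x * c - s)\<^sup>2)) =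
      12 * x\<^sup>2 * c ^ 3 + x * s + 81 * (c * s\<^sup>2) - (36 * x\<^sup>2 * c + 58 * x * s * c\<^sup>2)"
    by algebra
  also have "\<dots> > 0"
    using left_bound_hyperbolic[OF x] by (simp add: c_def s_def)
  finally show ?thesis
    using common_denominator_pos
    unfolding alpha_over_common_denominator beta_over_common_denominator tanh_over_common_denominator
    unfolding times_divide_eq_right diff_divide_distrib[symmetric]
    by (intro divide_strict_right_mono) (simp_all add: c_def s_def)
qed

text \<open>At \<open>p = q\<close> the slope is \<open>alpha x - q * (tanh x - beta x)\<close>,
  which decreases in \<open>q\<close>; for \<open>q = 4 / 5\<close> its negativity is
  \<open>alpha_upper_bound\<close>.\<close>

lemma slope_neg_high:
  assumes "q \<ge> 4 / 5" "p \<le> q"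
  shows "slope p q x < 0"
proof -
  have "p * beta x \<le> q * beta x"
    using beta_pos assms by simp
  moreover have "4 / 5 * (tanh x - beta x) \<le> q * (tanh x - beta x)"
    using alpha_upper_bound alpha_pos assms by (intro mult_right_mono) auto
  ultimately show ?thesis
    using alpha_upper_bound by (simp add: slope_def field_simps)
qed

text \<open>On the line \<open>p = 3 * q - 8 / 5\<close> the slope increases in \<open>q\<close>. At
  \<open>q = 4 / 5\<close> this line meets \<open>p = q\<close>, so \<open>alpha_upper_bound\<close>
  again decides.\<close>

lemma slope_neg_low:
  assumes "q \<le> 4 / 5" "p \<le> 3 * q - 8 / 5"
  shows "slope p q x < 0"
proof -
  have "p * beta x \<le> (3 * q - 8 / 5) * beta x"
    using beta_pos assms by simp
  \<comment> \<open>Eliminating \<open>alpha x\<close> from its two bounds gives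
    \<open>tanh x < 3 * beta x\<close>.\<close>
  moreover have "q * (3 * beta x - tanh x) \<le> 4 / 5 * (3 * beta x - tanh x)"
    using alpha_upper_bound alpha_lower_bound assms by (intro mult_right_mono) auto
  ultimately show ?thesis
    using alpha_upper_bound by (simp add: slope_def field_simps)
qed

text \<open>By the same monotonicity in \<open>q\<close> the worst case is
  \<open>q = 34 / 35\<close>, where \<open>3 * q - 8 / 5 = 46 / 35\<close> and the claim is
  \<open>alpha_lower_bound\<close>.\<close>

lemma slope_pos_high:
  assumes "q \<ge> 34 / 35" "p \<ge> 3 * q - 8 / 5"
  shows "slope p q x > 0"
proof -
  have "p * beta x \<ge> (3 * q - 8 / 5) * beta x"
    using beta_pos assms by simp
  moreover have "q * (3 * beta x - tanh x) \<ge> 34 / 35 * (3 * beta x - tanh x)"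
    using alpha_upper_bound alpha_lower_bound assms by (intro mult_right_mono) auto
  ultimately show ?thesis
    using alpha_lower_bound by (simp add: slope_def field_simps)
qed

text \<open>The ratio \<open>23 / 17\<close> is \<open>46 / 34\<close> from
  \<open>alpha_lower_bound\<close>; scaling that bound by \<open>q / 34\<close> leaves
  \<open>35 / 34 * q * alpha x\<close>, which is at most \<open>alpha x\<close>.\<close>

lemma slope_pos_low:
  assumes "0 < q" "q \<le> 34 / 35" "p \<ge> 23 * q / 17"
  shows "slope p q x > 0"
proof -
  have "p * beta x \<ge> 23 * q / 17 * beta x"
    using beta_pos assms by (intro mult_right_mono) auto
  moreover have "q * (tanh x - 23 / 17 * beta x) < q * (35 / 34 * alpha x)"
    using alpha_lower_bound assms by (intro mult_strict_left_mono) auto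
  moreover have "35 / 34 * q * alpha x \<le> 1 * alpha x"
    using alpha_pos assms by (intro mult_right_mono) auto
  ultimately show ?thesis
    by (simp add: slope_def algebra_simps)
qed

end

section \<open>Signs from derivatives, and limits at zero\<close>

text \<open>A one-sided limit replaces the value at 0, because the functions in question contain
  quotients singular there. The limit gives only a weak inequality at \<open>x / 2\<close>;
  monotonicity up to \<open>x\<close> makes it strict.\<close>

lemma pos_if_deriv_pos_tendsto_zero:
  fixes f f' :: "real \<Rightarrow> real"
  assumes "(f \<longlongrightarrow> 0) (at_right 0)" "x > 0"
    and deriv: "\<And>y. 0 < y \<Longrightarrow> y \<le> x \<Longrightarrow> (f has_real_derivative f' y) (at y)"
    and pos: "\<And>y. 0 < y \<Longrightarrow> y \<le> x \<Longrightarrow> f' y > 0"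
  shows "f x > 0"
proof -
  have mono: "f y < f z" if "0 < y" "y < z" "z \<le> x" for y z
    using that by (intro DERIV_pos_imp_increasing[of y z f])
      (meson deriv pos less_le_trans order.trans)+
  have "eventually (\<lambda>y. y \<in> {0<..<x / 2}) (at_right 0)"
    using \<open>x > 0\<close> by (intro eventually_at_right_real) auto
  then have "eventually (\<lambda>y. f y \<le> f (x / 2)) (at_right 0)"
    by eventually_elim (use \<open>x > 0\<close> in \<open>auto intro!: less_imp_le mono\<close>)
  then have "0 \<le> f (x / 2)"
    using assms(1) by (intro tendsto_upperbound[of f 0 "at_right 0"]) auto
  also have "\<dots> < f x"
    using \<open>x > 0\<close> by (intro mono) auto
  finally show ?thesis .
qed


lemma tendsto_alpha_over: "((\<lambda>x. alpha x / x) \<longlongrightarrow> 8 / 15) (at_right 0)"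
  unfolding alpha_def tanh_def by real_asymp

lemma tendsto_beta_over: "((\<lambda>x. beta x / x) \<longlongrightarrow> 1 / 3) (at_right 0)"
  unfolding beta_def by real_asymp

text \<open>The limit is a third of \<open>p - (3 * q - 8 / 5)\<close>, the source of this
  threshold.\<close>

lemma tendsto_slope_over:
  "((\<lambda>x. slope p q x / x) \<longlongrightarrow> 8 / 15 + p * (1 / 3) - q * 1) (at_right 0)"
proof -
  have "((\<lambda>x::real. tanh x / x) \<longlongrightarrow> 1) (at_right 0)"
    unfolding tanh_def by real_asymp
  then have "((\<lambda>x. alpha x / x + p * (beta x / x) - q * (tanh x / x)) \<longlongrightarrow>
      8 / 15 + p * (1 / 3) - q * 1) (at_right 0)"
    by (intro tendsto_intros tendsto_alpha_over tendsto_beta_over)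
  then show ?thesis
    by (simp add: slope_def add_divide_distrib diff_divide_distrib)
qed

section \<open>The Box-Cox transform and the reduction to one variable\<close>

definition box_cox :: "real \<Rightarrow> real \<Rightarrow> real" where
  "box_cox p s = (if p = 0 then ln s else (s powr p - 1) / p)"

lemma has_derivative_box_cox:
  "s > 0 \<Longrightarrow> (box_cox p has_real_derivative s powr (p - 1)) (at s)"
  unfolding box_cox_def
  by (cases "p = 0") (auto intro!: derivative_eq_intros simp: powr_minus_divide)

lemmas [derivative_intros] = has_derivative_box_cox[THEN DERIV_chain2]

lemma box_cox_1 [simp]: "box_cox p 1 = 0"
  by (simp add: box_cox_def)

lemma box_cox_less_iff:
  assumes "s > 0" "t > 0"
  shows "box_cox p s < box_cox p t \<longleftrightarrow> s < t"
proof -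
  have "box_cox p s < box_cox p t" if "0 < s" "s < t" for s t
    using that
    by (intro DERIV_pos_imp_increasing[of s t "box_cox p"])
      (auto intro!: exI[of _ "_ powr (p - 1)"] has_derivative_box_cox)
  from this[of s t] this[of t s] show ?thesis
    using assms by (cases s t rule: linorder_cases) auto
qed

text \<open>This is where \<open>Omega\<close> enters: for negative \<open>p\<close> it makes
  \<open>p / (3 * q)\<close> lie between 0 and 1, so the base is a convex combination of
  \<open>1\<close> and \<open>t powr q\<close>.\<close>

lemma M_base_pos:
  assumes "(p, q) \<in> Omega" "t > 1"
  shows "1 + p / 3 * box_cox q t > 0"
proof (cases "p \<ge> 0")
  case True
  then show ?thesis
    using box_cox_less_iff[of 1 t q] \<open>t > 1\<close> by (intro add_pos_nonneg) auto
next
  case False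
  then have "3 * q \<le> p" "p < 0"
    using assms(1) by (auto simp: Omega_def)
  then have "1 + p / 3 * box_cox q t = (1 - p / (3 * q)) + p / (3 * q) * t powr q"
    by (simp add: box_cox_def field_simps)
  also have "\<dots> > 0"
    using \<open>3 * q \<le> p\<close> \<open>p < 0\<close> \<open>t > 1\<close>
    by (intro add_nonneg_pos mult_pos_pos) (auto simp: divide_simps)
  finally show ?thesis .
qed

lemma M_eq:
  assumes "(p, q) \<in> Omega" "t > 1" "a > 0"
  shows "M p q (a * t) a =
    a * (if p = 0 then exp (box_cox q t / 3) else (1 + p / 3 * box_cox q t) powr (1 / p))"
proof (cases "p = 0 \<or> q = 0")
  case True
  then show ?thesis
    using assms by (auto simp: M_def box_cox_def powr_def add.commute)
next
  case False
  have "(1 - p / (3 * q)) * a powr q + p / (3 * q) * (a * t) powr q =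
      (1 + p / 3 * box_cox q t) * a powr q"
    using False assms by (simp add: box_cox_def powr_mult field_simps)
  then show ?thesis
    using False assms M_base_pos[OF assms(1,2)]
    by (simp add: M_def powr_mult powr_powr flip: powr_add)
qed

lemma SB_cosh:
  assumes "a > 0" "x > 0"
  shows "SB (a * cosh x) a = a * (sinh x / x)"
proof -
  have "(a * cosh x)\<^sup>2 - a\<^sup>2 = (a * sinh x)\<^sup>2"
    by (simp add: power_mult_distrib cosh_square_eq algebra_simps)
  then show ?thesis
    using assms by (simp add: SB_def arcosh_cosh_real abs_mult)
qed

definition gap :: "real \<Rightarrow> real \<Rightarrow> real \<Rightarrow> real" where
  "gap p q x = 3 * box_cox p (sinh x / x) - box_cox q (cosh x)"

lemma M_vs_SB:
  assumes "(p, q) \<in> Omega" "a > 0" "x > 0"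
  shows "M p q (a * cosh x) a < SB (a * cosh x) a \<longleftrightarrow> 0 < gap p q x"
    and "SB (a * cosh x) a < M p q (a * cosh x) a \<longleftrightarrow> gap p q x < 0"
proof -
  define m where
    "m = (if p = 0 then exp (box_cox q (cosh x) / 3)
          else (1 + p / 3 * box_cox q (cosh x)) powr (1 / p))"
  have "cosh x > 1"
    using \<open>x > 0\<close> cosh_real_strict_mono[of 0 x] by simp
  then have M: "M p q (a * cosh x) a = a * m" and base: "1 + p / 3 * box_cox q (cosh x) > 0"
    using M_eq M_base_pos assms by (auto simp: m_def)
  have "m > 0"
    using base by (simp add: m_def)
  \<comment> \<open>Thus \<open>m\<close>, the mean divided by \<open>a\<close>, is the zero in
    \<open>s\<close> of \<open>3 * box_cox p s - box_cox q (cosh x)\<close>, and strict monotonicity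
    of \<open>box_cox p\<close> turns the comparison into the sign of \<open>gap\<close>.\<close>
  have "3 * box_cox p m = box_cox q (cosh x)"
    using base unfolding m_def by (simp add: box_cox_def[of p] powr_powr)
  then have gap: "gap p q x = 3 * (box_cox p (sinh x / x) - box_cox p m)"
    by (simp add: gap_def)
  have "sinh x / x > 0"
    using \<open>x > 0\<close> by simp
  then show "M p q (a * cosh x) a < SB (a * cosh x) a \<longleftrightarrow> 0 < gap p q x"
    using box_cox_less_iff[of m "sinh x / x" p] \<open>m > 0\<close> \<open>a > 0\<close>
    unfolding M SB_cosh[OF assms(2,3)] gap by (simp only: mult_less_cancel_left_pos) auto
  show "SB (a * cosh x) a < M p q (a * cosh x) a \<longleftrightarrow> gap p q x < 0"
    using box_cox_less_iff[of "sinh x / x" m p] \<open>m > 0\<close> \<open>a > 0\<close> \<open>sinh x / x > 0\<close>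
    unfolding M SB_cosh[OF assms(2,3)] gap by (simp only: mult_less_cancel_left_pos) auto
qed

lemma all_pairs_iff:
  "(\<forall>a b :: real. 0 < a \<and> a < b \<longrightarrow> P b a) \<longleftrightarrow> (\<forall>a x. 0 < a \<and> 0 < x \<longrightarrow> P (a * cosh x) a)"
proof (intro iffI allI impI)
  fix a x :: real
  assume "\<forall>a b :: real. 0 < a \<and> a < b \<longrightarrow> P b a" "0 < a \<and> 0 < x"
  then show "P (a * cosh x) a"
    using cosh_real_strict_mono[of 0 x] by simp
next
  fix a b :: real
  assume *: "\<forall>a x. 0 < a \<and> 0 < x \<longrightarrow> P (a * cosh x) a" and "0 < a \<and> a < b"
  then have "b / a > 1" by simp
  then have "cosh (arcosh (b / a)) = b / a" "arcosh (b / a) > 0"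
    by (auto simp: arcosh_real_gt_1_iff)
  then show "P b a"
    using *[rule_format, of a "arcosh (b / a)"] \<open>0 < a \<and> a < b\<close> by simp
qed

section \<open>The sign of \<open>gap\<close>, near zero and at infinity\<close>

text \<open>Signs pass from \<open>slope\<close> to its antiderivative \<open>h\<close>, then to
  \<open>exp h - 1\<close>, a positive multiple of which is the derivative of \<open>gap\<close>.
  The factor \<open>\<sigma>\<close> treats both signs at once, and the hypothesis only up to
  \<open>x\<close> permits local use.\<close>

lemma gap_sign:
  assumes "\<sigma> = 1 \<or> \<sigma> = (-1 :: real)" "x > 0"
    and slope: "\<And>y. 0 < y \<Longrightarrow> y \<le> x \<Longrightarrow> 0 < \<sigma> * slope p q y"
  shows "0 < \<sigma> * gap p q x"
proof (rule pos_if_deriv_pos_tendsto_zero[where x = x])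
  \<comment> \<open>The logarithm of the ratio of the two terms in the derivative of
    \<open>gap\<close>.\<close>
  define h where "h y = ln (3 * (y * cosh y - sinh y) / (y\<^sup>2 * sinh y))
    + (p - 1) * ln (sinh y / y) - (q - 1) * ln (cosh y)" for y :: real
  have h_pos: "0 < \<sigma> * h y" if "0 < y" "y \<le> x" for y
  proof (rule pos_if_deriv_pos_tendsto_zero[where x = y])
    have "((\<lambda>y::real. ln (3 * (y * cosh y - sinh y) / (y\<^sup>2 * sinh y))) \<longlongrightarrow> 0) (at_right 0)"
      by real_asymp
    moreover have "((\<lambda>y::real. ln (sinh y / y)) \<longlongrightarrow> 0) (at_right 0)"
      by real_asymp
    moreover have "((\<lambda>y::real. ln (cosh y)) \<longlongrightarrow> 0) (at_right 0)"
      by real_asymp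
    ultimately have "((\<lambda>y. \<sigma> * h y) \<longlongrightarrow> \<sigma> * (0 + (p - 1) * 0 - (q - 1) * 0)) (at_right 0)"
      unfolding h_def by (intro tendsto_intros)
    then show "((\<lambda>y. \<sigma> * h y) \<longlongrightarrow> 0) (at_right 0)" by simp
  next
    fix z assume z: "0 < z" "z \<le> y"
    then show "0 < \<sigma> * slope p q z"
      using slope \<open>y \<le> x\<close> by simp
    have D: "z * cosh z - sinh z > 0"
      using sinh_less_times_cosh z by simp
    have "((\<lambda>y. ln (3 * (y * cosh y - sinh y) / (y\<^sup>2 * sinh y))) has_real_derivative
        z * sinh z / (z * cosh z - sinh z) - 2 / z - cosh z / sinh z) (at z)"
      using D z by (auto intro!: derivative_eq_intros simp: power2_eq_square) (simp add: field_simps)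
    moreover have "((\<lambda>y. ln (sinh y / y)) has_real_derivative cosh z / sinh z - 1 / z) (at z)"
      using z by (auto intro!: derivative_eq_intros) (simp add: field_simps)
    moreover have "((\<lambda>y. ln (cosh y)) has_real_derivative tanh z) (at z)"
      by (auto intro!: derivative_eq_intros simp: tanh_def)
    ultimately have "((\<lambda>y. \<sigma> * h y) has_real_derivative
       \<sigma> * (z * sinh z / (z * cosh z - sinh z) - 2 / z - cosh z / sinh z
         + (p - 1) * (cosh z / sinh z - 1 / z) - (q - 1) * tanh z)) (at z)"
      unfolding h_def by (intro DERIV_cmult DERIV_add DERIV_diff)
    moreover have "z * sinh z / (z * cosh z - sinh z) - 2 / z - cosh z / sinh z
        + (p - 1) * (cosh z / sinh z - 1 / z) - (q - 1) * tanh z = slope p q z"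
      by (simp add: slope_def alpha_def beta_def algebra_simps add_divide_distrib diff_divide_distrib)
    ultimately show "((\<lambda>y. \<sigma> * h y) has_real_derivative \<sigma> * slope p q z) (at z)"
      by simp
  qed (use that in auto)
  have "((\<lambda>x::real. sinh x / x) \<longlongrightarrow> 1) (at_right 0)" "(cosh \<longlongrightarrow> (1::real)) (at_right 0)"
    by real_asymp+
  then have "((\<lambda>x. \<sigma> * gap p q x) \<longlongrightarrow> \<sigma> * (3 * box_cox p 1 - box_cox q 1)) (at_right 0)"
    unfolding gap_def
    by (intro tendsto_intros isCont_tendsto_compose[of 1 "box_cox _"]
          DERIV_isCont[OF has_derivative_box_cox]) auto
  then show "((\<lambda>x. \<sigma> * gap p q x) \<longlongrightarrow> 0) (at_right 0)" by simp
  fix y assume y: "0 < y" "y \<le> x"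
  have D: "y * cosh y - sinh y > 0"
    using sinh_less_times_cosh y by simp
  have "((\<lambda>x. \<sigma> * gap p q x) has_real_derivative
      \<sigma> * (3 * ((sinh y / y) powr (p - 1) * ((y * cosh y - sinh y) / y\<^sup>2))
             - cosh y powr (q - 1) * sinh y)) (at y)"
    unfolding gap_def using y
    by (auto intro!: derivative_eq_intros simp: power2_eq_square)
  also have "3 * ((sinh y / y) powr (p - 1) * ((y * cosh y - sinh y) / y\<^sup>2)) =
      cosh y powr (q - 1) * sinh y * exp (h y)"
    using y D by (simp add: h_def powr_def exp_add exp_diff)
  finally show "((\<lambda>x. \<sigma> * gap p q x) has_real_derivative
      cosh y powr (q - 1) * sinh y * (\<sigma> * (exp (h y) - 1))) (at y)"
    by (simp add: algebra_simps)
  have "cosh y powr (q - 1) * sinh y > 0"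
    using y by simp
  moreover have "\<sigma> * (exp (h y) - 1) > 0"
    using h_pos[OF y] assms(1) by auto
  ultimately show "cosh y powr (q - 1) * sinh y * (\<sigma> * (exp (h y) - 1)) > 0"
    by (rule mult_pos_pos)
qed (use assms in auto)

text \<open>The limit of \<open>slope p q x / x\<close> fixes the sign of \<open>slope\<close> on
  some interval to the right of 0, which suffices for \<open>gap_sign\<close>.\<close>

lemma gap_sign_near_zero:
  assumes "\<sigma> = 1 \<or> \<sigma> = (-1 :: real)" "0 < \<sigma> * (p - (3 * q - 8 / 5))"
  shows "\<exists>x>0. 0 < \<sigma> * gap p q x"
proof -
  have "((\<lambda>x. \<sigma> * (slope p q x / x)) \<longlongrightarrow> \<sigma> * (8 / 15 + p * (1 / 3) - q * 1)) (at_right 0)"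
    by (intro tendsto_intros tendsto_slope_over)
  moreover have "0 < \<sigma> * (8 / 15 + p * (1 / 3) - q * 1)"
    using assms by auto
  ultimately have "eventually (\<lambda>x. 0 < \<sigma> * (slope p q x / x)) (at_right 0)"
    by (rule order_tendstoD(1))
  then obtain b where b: "b > 0" "\<And>y. 0 < y \<Longrightarrow> y < b \<Longrightarrow> 0 < \<sigma> * (slope p q y / y)"
    by (auto simp: eventually_at_right_field)
  have "0 < \<sigma> * slope p q y" if "0 < y" "y \<le> b / 2" for y
    using b(2)[of y] that by (simp add: zero_less_divide_iff)
  then have "0 < \<sigma> * gap p q (b / 2)"
    using b(1) assms(1) by (intro gap_sign) auto
  then show ?thesis
    using b(1) by (intro exI[of _ "b / 2"]) auto
qed

text \<open>Since \<open>p > q\<close>, the exponential growth of \<open>(sinh x / x) powr p\<close>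
  beats that of \<open>cosh x powr q\<close> despite the denominator \<open>x\<close>.\<close>

lemma gap_pos_at_infinity:
  assumes "0 < q" "q < p"
  shows "\<exists>x>0. 0 < gap p q x"
proof -
  have "filterlim (\<lambda>x. p * ln (sinh x / x) - q * ln (cosh x)) at_top at_top"
    using assms by real_asymp
  \<comment> \<open>The summand 1 in the threshold leaves a spare
    \<open>cosh x powr q \<ge> 1\<close>, which covers the constants of the Box-Cox
    transforms.\<close>
  then have "eventually (\<lambda>x. p * ln (sinh x / x) - q * ln (cosh x) \<ge> ln (p / (3 * q) + 1)) at_top"
    by (simp add: filterlim_at_top)
  then have "eventually (\<lambda>x. x > 0 \<and>
      p * ln (sinh x / x) - q * ln (cosh x) \<ge> ln (p / (3 * q) + 1)) at_top"
    using eventually_gt_at_top[of 0] by eventually_elim auto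
  then obtain x where x: "x > 0" "p * ln (sinh x / x) \<ge> ln (p / (3 * q) + 1) + q * ln (cosh x)"
    unfolding eventually_at_top_linorder by force
  have "exp (ln (p / (3 * q) + 1) + q * ln (cosh x)) = (p / (3 * q) + 1) * cosh x powr q"
    using assms by (simp add: exp_add powr_def add_pos_pos)
  moreover have "exp (p * ln (sinh x / x)) = (sinh x / x) powr p"
    using x(1) by (simp add: powr_def)
  ultimately have "(sinh x / x) powr p \<ge> (p / (3 * q) + 1) * cosh x powr q"
    using x(2) by (metis exp_le_cancel_iff)
  moreover have "cosh x powr q \<ge> 1"
    using assms cosh_real_ge_1 by (intro ge_one_powr_ge_zero) auto
  moreover define r where "r = p / (3 * q)"
  moreover have "r > 0"
    using assms by (simp add: r_def)
  ultimately have "r * (cosh x powr q - 1) < (sinh x / x) powr p - 1"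
    unfolding r_def[symmetric] distrib_right right_diff_distrib by linarith
  then have "p / 3 * box_cox q (cosh x) < p * box_cox p (sinh x / x)"
    using assms by (simp add: box_cox_def r_def)
  then have "0 < gap p q x"
    using assms mult_less_cancel_left_pos[of p "box_cox q (cosh x) / 3" "box_cox p (sinh x / x)"]
    by (simp add: gap_def)
  with x(1) show ?thesis by blast
qed


section \<open>Combination of the sufficient and the necessary conditions\<close>

theorem theorem6:
  fixes q p1 p2 :: real
  assumes "(p1, q) \<in> Omega" and "(p2, q) \<in> Omega"
  shows
    "(34 / 35 \<le> q \<longrightarrow>
        ((\<forall>a b :: real. 0 < a \<and> a < b \<longrightarrow> M p1 q b a < SB b a \<and> SB b a < M p2 q b a)
          \<longleftrightarrow> p1 \<ge> 3 * q - 8 / 5 \<and> p2 \<le> q))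
     \<and>
     (4 / 5 \<le> q \<and> q < 34 / 35 \<longrightarrow>
        (p1 \<ge> 23 * q / 17 \<longrightarrow> (\<forall>a b :: real. 0 < a \<and> a < b \<longrightarrow> M p1 q b a < SB b a))
        \<and>
        ((\<forall>a b :: real. 0 < a \<and> a < b \<longrightarrow> SB b a < M p2 q b a) \<longleftrightarrow> p2 \<le> q))
     \<and>
     (0 < q \<and> q < 4 / 5 \<longrightarrow>
        (p1 \<ge> 23 * q / 17 \<longrightarrow> (\<forall>a b :: real. 0 < a \<and> a < b \<longrightarrow> M p1 q b a < SB b a))
        \<and>
        ((\<forall>a b :: real. 0 < a \<and> a < b \<longrightarrow> SB b a < M p2 q b a) \<longleftrightarrow> p2 \<le> 3 * q - 8 / 5))
     \<and>
     (q \<le> 0 \<longrightarrow>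
        ((\<forall>a b :: real. 0 < a \<and> a < b \<longrightarrow> M p1 q b a < SB b a \<and> SB b a < M p2 q b a)
          \<longleftrightarrow> p1 \<ge> q \<and> p2 \<le> 3 * q - 8 / 5))"
proof -
  let ?L = "\<lambda>p. \<forall>a b :: real. 0 < a \<and> a < b \<longrightarrow> M p q b a < SB b a"
  let ?R = "\<lambda>p. \<forall>a b :: real. 0 < a \<and> a < b \<longrightarrow> SB b a < M p q b a"
  note L_iff = all_pairs_iff[of "\<lambda>b a. M p1 q b a < SB b a"]
  note R_iff = all_pairs_iff[of "\<lambda>b a. SB b a < M p2 q b a"]
  have L: "?L p1" if "\<And>x. x > 0 \<Longrightarrow> slope p1 q x > 0"
    unfolding L_iff using that gap_sign[of 1 _ p1 q] M_vs_SB(1)[OF assms(1)] by auto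
  have R: "?R p2" if "\<And>x. x > 0 \<Longrightarrow> slope p2 q x < 0"
    unfolding R_iff using that gap_sign[of "-1" _ p2 q] M_vs_SB(2)[OF assms(2)] by auto
  \<comment> \<open>For necessity the pairs with \<open>a = 1\<close> are enough.\<close>
  have gap_L: "gap p1 q x > 0" if "?L p1" "x > 0" for x
    using that(1) M_vs_SB(1)[OF assms(1), of 1 x] that(2)
    unfolding L_iff by (metis mult_1 zero_less_one)
  have gap_R: "gap p2 q x < 0" if "?R p2" "x > 0" for x
    using that(1) M_vs_SB(2)[OF assms(2), of 1 x] that(2)
    unfolding R_iff by (metis mult_1 zero_less_one)
  have L_zero: "p1 \<ge> 3 * q - 8 / 5" if "?L p1"
    using gap_sign_near_zero[of "-1" p1 q] gap_L[OF that] by force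
  have R_zero: "p2 \<le> 3 * q - 8 / 5" if "?R p2"
    using gap_sign_near_zero[of 1 p2 q] gap_R[OF that] by force
  have R_infinity: "p2 \<le> q" if "?R p2" "q > 0"
    using gap_pos_at_infinity[of q p2] gap_R[OF that(1)] that(2) by force
  have both: "(\<forall>a b :: real. 0 < a \<and> a < b \<longrightarrow> M p1 q b a < SB b a \<and> SB b a < M p2 q b a)
      \<longleftrightarrow> ?L p1 \<and> ?R p2"
    by blast
  \<comment> \<open>Naming both quantified inequalities reduces the goal to a propositional check
    over the ranges of \<open>q\<close>.\<close>
  define l r where "l \<longleftrightarrow> ?L p1" and "r \<longleftrightarrow> ?R p2"
  have "l \<longleftrightarrow> p1 \<ge> 3 * q - 8 / 5" if "34 / 35 \<le> q"
    unfolding l_def using L_zero L slope_pos_high that by blast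
  moreover have "r \<longleftrightarrow> p2 \<le> q" if "4 / 5 \<le> q"
    unfolding r_def using R_infinity R slope_neg_high that by fastforce
  moreover have "l" if "0 < q" "q < 34 / 35" "p1 \<ge> 23 * q / 17"
    unfolding l_def using L slope_pos_low that by (meson less_imp_le)
  moreover have "r \<longleftrightarrow> p2 \<le> 3 * q - 8 / 5" if "q < 4 / 5"
    unfolding r_def using R_zero R slope_neg_low that by (meson less_imp_le)
  \<comment> \<open>On \<open>Omega\<close>, part (iv) is vacuous: \<open>q \<le> 0\<close> forces \<open>p2 \<ge> 3 * q\<close>.\<close>
  moreover have "\<not> p2 \<le> 3 * q - 8 / 5" if "q \<le> 0"
    using assms(2) that by (auto simp: Omega_def)
  ultimately show ?thesis
    unfolding both l_def[symmetric] r_def[symmetric]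
    by (cases "34 / 35 \<le> q"; cases "4 / 5 \<le> q"; cases "0 < q"; simp; blast)
qed

end
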